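(* Let $\hat X_{k-1}\subset\mathbb{R}^{n_x}$, $W\subset\mathbb{R}^{n_w}$, $V\subset\mathbb{R}^{n_v}$ be nonempty constrained zonotopes, let $\mathbf{u}_{k-1}\in\mathbb{R}^{n_u}$ and $\mathbf{y}_k\in\mathbb{R}^{n_y}$ be given, and let $\mathbf{f}$ and $\mathbf{g}$ be factorable. Put $n_s=n_x+n_w+n_v$, $S\triangleq\hat X_{k-1}\times W\times V$, and let $\boldsymbol{\zeta}=(\zeta_1,\ldots,\zeta_{n_z})$, $\mathbf{E}_\ell$, $\mathbf{E}_f$ be the factors and selection matrices (defined in the context) of the composite function $\boldsymbol{\ell}(\mathbf{x}_{k-1},\mathbf{w}_{k-1},\mathbf{v}_k)=\mathbf{g}(\mathbf{f}(\mathbf{x}_{k-1},\mathbf{w}_{k-1},\mathbf{u}_{k-1}),\mathbf{v}_k)$. Let $$\underline{X}_k\triangleq\left\{\mathbf{x}_k\in\mathbb{R}^{n_x}:\ \mathbf{x}_k=\mathbf{f}(\mathbf{x}_{k-1},\mathbf{w}_{k-1},\mathbf{u}_{k-1}),\ \mathbf{y}_k=\mathbf{g}(\mathbf{x}_k,\mathbf{v}_k)\ \text{for some}\ (\mathbf{x}_{k-1},\mathbf{w}_{k-1},\mathbf{v}_k)\in\hat X_{k-1}\times W\times V\right\}.$$ Let $Z\subset\mathbb{R}^{n_z}$ be a compact interval and $P_\ell\subset\mathbb{R}^{n_z}$ a convex polyhedron, each containing $\boldsymbol{\zeta}(\square S)$. Let $\tilde Z$ denote the interval in $\mathbb{R}^{n_z-n_s}$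 formed by the last $n_z-(n_x+n_w+n_v)$ components of $Z$, and define $P_y\triangleq\{\mathbf{z}\in\mathbb{R}^{n_z}:\mathbf{E}_\ell\mathbf{z}=\mathbf{y}_k\}$. Then $$\underline{X}_k\subseteq\hat X_k\triangleq\mathbf{E}_f\big((\hat X_{k-1}\times W\times V\times\tilde Z)\cap P_\ell\cap P_y\big).$$
   Context: A constrained zonotope in $\mathbb{R}^n$ is a set of the form $\{\mathbf{c}+\mathbf{G}\boldsymbol{\xi}:\|\boldsymbol{\xi}\|_\infty\le1,\ \mathbf{A}\boldsymbol{\xi}=\mathbf{b}\}$. A convex polyhedron is a set $\{\mathbf{x}:\mathbf{H}\mathbf{x}\le\mathbf{k},\ \mathbf{A}\mathbf{x}=\mathbf{b}\}$. For a bounded set $S$, $\square S$ is its interval hull (the smallest compact box containing it). For a matrix $\mathbf{R}$ and set $Y$, $\mathbf{R}Y\triangleq\{\mathbf{R}\mathbf{y}:\mathbf{y}\in Y\}$; for a function $\mathbf{h}$, $\mathbf{h}(Y)\triangleq\{\mathbf{h}(\mathbf{y}):\mathbf{y}\in Y\}$. Factorable function. Fix a library $\mathcal{L}$ of real-valued univariate functions. A function $\boldsymbol{\varphi}:D\subseteq\mathbb{R}^{n_s}\to\mathbb{R}^{n_\varphi}$ is factorable if it can be expressed through a finite sequence of factors $\zeta_j:D\to\mathbb{R}$, $j\in\{1,\ldots,n_z\}$, such that: (1) for $j\le n_s$, $\zeta_j(\mathbf{s})=s_j$; (2) for each $j>n_s$, either (a) $\zeta_j(\mathbf{s})=\zeta_a(\mathbf{s})\odot\zeta_b(\mathbf{s})$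 for some $a,b<j$ and $\odot\in\{+,-,\times,/\}$, or (b) $\zeta_j(\mathbf{s})=\beta_j(\zeta_a(\mathbf{s}))$ for some $a<j$ and $\beta_j\in\mathcal{L}$ (for all $\mathbf{s}\in D$); (3) $\boldsymbol{\varphi}(\mathbf{s})=\mathbf{E}_\varphi\boldsymbol{\zeta}(\mathbf{s})$, where $\mathbf{E}_\varphi\in\mathbb{R}^{n_\varphi\times n_z}$ is zero except for a single $1$ in each row. Setting. The functions $\mathbf{f}:\mathbb{R}^{n_x}\times\mathbb{R}^{n_w}\times\mathbb{R}^{n_u}\to\mathbb{R}^{n_x}$ and $\mathbf{g}:\mathbb{R}^{n_x}\times\mathbb{R}^{n_v}\to\mathbb{R}^{n_y}$ are factorable, and $\mathbf{u}_{k-1}$ is a known constant. Write $\mathbf{s}=(\mathbf{x}_{k-1},\mathbf{w}_{k-1},\mathbf{v}_k)\in\mathbb{R}^{n_s}$. The composite $\boldsymbol{\ell}(\mathbf{s})$ is factorable; $\boldsymbol{\zeta}=(\zeta_1,\ldots,\zeta_{n_z})$ are its factors (defined on a domain containing $\square S$), obtained by first factoring $\mathbf{f}(\cdot,\cdot,\mathbf{u}_{k-1})$ and then $\mathbf{g}$, so that there are matrices $\mathbf{E}_\ell\in\mathbb{R}^{n_y\times n_z}$ and $\mathbf{E}_f\in\mathbb{R}^{n_x\times n_z}$, each with a single $1$ per row and zeros elsewhere, satisfying $\boldsymbol{\ell}(\mathbf{s})=\mathbf{E}_\ell\boldsymbol{\zeta}(\mathbf{s})$ and $\mathbf{f}(\mathbf{x}_{k-1},\mathbf{w}_{k-1},\mathbf{u}_{k-1})=\mathbf{E}_f\boldsymbol{\zeta}(\mathbf{s})$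 for all $\mathbf{s}$ in that domain. *)

theory Defs
  imports "Jordan_Normal_Form.Matrix" "HOL-Library.FuncSet"
begin

text \<open>
  Points of R^n are vectors in \<open>carrier_vec n\<close>. A Cartesian product of subsets of R^m and R^n is
  the subset of R^(m+n) of all concatenations, and functions of several vector arguments take the
  concatenation of their arguments. Components and factors are indexed from 0.
\<close>

definition vec_times :: "'a vec set \<Rightarrow> 'a vec set \<Rightarrow> 'a vec set" (infixr \<open>\<times>\<^sub>v\<close> 80) where
  "X \<times>\<^sub>v Y = {x @\<^sub>v y | x y. x \<in> X \<and> y \<in> Y}"

text \<open>The inserted \<open>0\<close> only matters for the vector of dimension 0.\<close>

definition linf_norm_vec :: "real vec \<Rightarrow> real" where
  "linf_norm_vec v = Max (insert 0 ((\<lambda>i. \<bar>v $ i\<bar>) ` {..<dim_vec v}))"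

definition constrained_zonotope :: "nat \<Rightarrow> real vec set \<Rightarrow> bool" where
  "constrained_zonotope n X \<longleftrightarrow>
    (\<exists>ng nc. \<exists>c \<in> carrier_vec n. \<exists>G \<in> carrier_mat n ng. \<exists>A \<in> carrier_mat nc ng. \<exists>b \<in> carrier_vec nc.
      X = {c + G *\<^sub>v \<xi> | \<xi>. \<xi> \<in> carrier_vec ng \<and> linf_norm_vec \<xi> \<le> 1 \<and> A *\<^sub>v \<xi> = b})"

definition convex_polyhedron :: "nat \<Rightarrow> real vec set \<Rightarrow> bool" where
  "convex_polyhedron n P \<longleftrightarrow>
    (\<exists>m p. \<exists>H \<in> carrier_mat m n. \<exists>k \<in> carrier_vec m. \<exists>A \<in> carrier_mat p n. \<exists>b \<in> carrier_vec p.
      P = {x \<in> carrier_vec n. H *\<^sub>v x \<le> k \<and> A *\<^sub>v x = b})"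

text \<open>The order on vectors is componentwise and relates only vectors of equal dimension.\<close>

definition compact_interval :: "nat \<Rightarrow> real vec set \<Rightarrow> bool" where
  "compact_interval n B \<longleftrightarrow> (\<exists>l \<in> carrier_vec n. \<exists>u \<in> carrier_vec n. l \<le> u \<and> B = {l..u})"

definition interval_hull :: "nat \<Rightarrow> real vec set \<Rightarrow> real vec set" where
  "interval_hull n S = (LEAST B. compact_interval n B \<and> S \<subseteq> B)"

lemma interval_hull_exists:
  assumes ne: "S \<noteq> {}" and l: "l \<in> carrier_vec n" and u: "u \<in> carrier_vec n" and S: "S \<subseteq> {l..u}"
  shows "compact_interval n (interval_hull n S)"
    and "S \<subseteq> interval_hull n S"
    and "\<And>B. compact_interval n B \<Longrightarrow> S \<subseteq> B \<Longrightarrow> interval_hull n S \<subseteq> B"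
proof -
  define a where "a = vec n (\<lambda>i. INF s\<in>S. s $ i)"
  define b where "b = vec n (\<lambda>i. SUP s\<in>S. s $ i)"
  have bounds: "dim_vec s = n" "\<And>i. i < n \<Longrightarrow> l $ i \<le> s $ i" "\<And>i. i < n \<Longrightarrow> s $ i \<le> u $ i"
    if "s \<in> S" for s
  proof -
    have "l \<le> s" "s \<le> u" using that S by auto
    thus "dim_vec s = n" "\<And>i. i < n \<Longrightarrow> l $ i \<le> s $ i" "\<And>i. i < n \<Longrightarrow> s $ i \<le> u $ i"
      using u by (simp_all add: less_eq_vec_def)
  qed
  have bdb: "bdd_below ((\<lambda>s. s $ i) ` S)" if "i < n" for i
    using bounds(2) that by (intro bdd_belowI2)
  have bda: "bdd_above ((\<lambda>s. s $ i) ` S)" if "i < n" for i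
    using bounds(3) that by (intro bdd_aboveI2)
  have mem: "a \<le> s \<and> s \<le> b" if s: "s \<in> S" for s
  proof -
    have "(INF t\<in>S. t $ i) \<le> s $ i" "s $ i \<le> (SUP t\<in>S. t $ i)" if "i < n" for i
      by (rule cINF_lower[OF bdb[OF that] s], rule cSUP_upper[OF s bda[OF that]])
    thus ?thesis using bounds(1)[OF s] by (simp add: less_eq_vec_def a_def b_def)
  qed
  hence sub: "S \<subseteq> {a..b}" by (simp add: subset_eq)
  from ne obtain s where "s \<in> S" by blast
  from mem[OF this] have "a \<le> b" by (elim conjE) (rule order_trans)
  moreover have "a \<in> carrier_vec n" "b \<in> carrier_vec n" by (simp_all add: a_def b_def)
  ultimately have ci: "compact_interval n {a..b}"
    unfolding compact_interval_def by blast
  have min: "{a..b} \<subseteq> B" if B: "compact_interval n B" "S \<subseteq> B" for B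
  proof -
    obtain l' u' where lu: "l' \<in> carrier_vec n" "u' \<in> carrier_vec n" "B = {l'..u'}"
      using B(1) unfolding compact_interval_def by blast
    have in_B: "l' \<le> s" "s \<le> u'" if "s \<in> S" for s
      using subsetD[OF B(2) that] lu(3) by simp_all
    have comp: "l' $ i \<le> s $ i" "s $ i \<le> u' $ i" if "s \<in> S" "i < n" for s i
      using in_B[OF that(1)] that(2) bounds(1)[OF that(1)] lu(1,2)
      by (simp_all add: less_eq_vec_def)
    have "l' $ i \<le> (INF s\<in>S. s $ i)" "(SUP s\<in>S. s $ i) \<le> u' $ i" if "i < n" for i
      by (rule cINF_greatest[OF ne comp(1)[OF _ that]], assumption,
          rule cSUP_least[OF ne comp(2)[OF _ that]], assumption)
    hence "l' \<le> a" "b \<le> u'"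
      using lu(1,2) by (simp_all add: less_eq_vec_def a_def b_def)
    thus ?thesis unfolding lu(3) by (simp add: atLeastatMost_subset_iff)
  qed
  have eq: "interval_hull n S = {a..b}"
    unfolding interval_hull_def
  proof (rule Least_equality)
    show "compact_interval n {a..b} \<and> S \<subseteq> {a..b}" using ci sub by (rule conjI)
    show "{a..b} \<subseteq> B" if "compact_interval n B \<and> S \<subseteq> B" for B
      using that by (elim conjE) (rule min)
  qed
  show "compact_interval n (interval_hull n S)" "S \<subseteq> interval_hull n S"
    unfolding eq by (rule ci, rule sub)
  show "interval_hull n S \<subseteq> B" if "compact_interval n B" "S \<subseteq> B" for B
    unfolding eq using that by (rule min)
qed

text \<open>
  The members of the library \<open>L\<close> are partial functions, so that for instance the logarithm is only
  applied to factors taking values in its domain. Since \<open>x / 0 = 0\<close> in HOL, a quotient of factors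
  requires explicitly that the denominator does not vanish on \<open>D\<close>.
\<close>

definition factor_sequence ::
  "(real \<rightharpoonup> real) set \<Rightarrow> nat \<Rightarrow> nat \<Rightarrow> real vec set \<Rightarrow> (real vec \<Rightarrow> real vec) \<Rightarrow> bool" where
  "factor_sequence L ns nz D \<zeta> \<longleftrightarrow>
    ns \<le> nz \<and> D \<subseteq> carrier_vec ns \<and> \<zeta> \<in> D \<rightarrow> carrier_vec nz \<and>
    (\<forall>j < ns. \<forall>s \<in> D. \<zeta> s $ j = s $ j) \<and>
    (\<forall>j \<in> {ns..<nz}.
      (\<exists>a < j. \<exists>b < j.
        (\<forall>s \<in> D. \<zeta> s $ j = \<zeta> s $ a + \<zeta> s $ b) \<or>
        (\<forall>s \<in> D. \<zeta> s $ j = \<zeta> s $ a - \<zeta> s $ b) \<or>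
        (\<forall>s \<in> D. \<zeta> s $ j = \<zeta> s $ a * \<zeta> s $ b) \<or>
        (\<forall>s \<in> D. \<zeta> s $ b \<noteq> 0 \<and> \<zeta> s $ j = \<zeta> s $ a / \<zeta> s $ b)) \<or>
      (\<exists>a < j. \<exists>\<beta> \<in> L. \<forall>s \<in> D. \<beta> (\<zeta> s $ a) = Some (\<zeta> s $ j)))"

definition selection_matrix :: "nat \<Rightarrow> nat \<Rightarrow> real mat \<Rightarrow> bool" where
  "selection_matrix m n E \<longleftrightarrow> E \<in> carrier_mat m n \<and> (\<forall>i < m. \<exists>j < n. row E i = unit_vec n j)"

definition factorable ::
  "(real \<rightharpoonup> real) set \<Rightarrow> nat \<Rightarrow> nat \<Rightarrow> real vec set \<Rightarrow> (real vec \<Rightarrow> real vec) \<Rightarrow> bool" where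
  "factorable L ns n\<phi> D \<phi> \<longleftrightarrow>
    (\<exists>nz \<zeta> E. factor_sequence L ns nz D \<zeta> \<and> selection_matrix n\<phi> nz E \<and> (\<forall>s \<in> D. \<phi> s = E *\<^sub>v \<zeta> s))"

end

(* The true triple s = (x, w, v) lies in S, which is bounded as a product of constrained zonotopes,
   so S is contained in its interval hull and the factor vector z = zeta(s) lies in Z and in Pl.
   Since the first ns factors are s itself, z = (x, w, v, t) with t in the tail of Z; the
   measurement equation places z in Py, and Ef reads off the state from z. *)
theory Submission
  imports Defs
begin

text \<open>The coefficients \<open>\<xi>\<close> range over part of the unit cube, so coordinate
  \<open>i\<close> strays from \<open>c $ i\<close> by at most the sum of absolute values in row
  \<open>i\<close> of \<open>G\<close>. The constraint \<open>A *\<^sub>v \<xi> = b\<close> only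
  removes points. Boundedness is what gives the \<open>LEAST\<close> in \<open>interval_hull\<close>
  its meaning.\<close>

lemma constrained_zonotope_bounded:
  assumes "constrained_zonotope n X"
  obtains l u where "l \<in> carrier_vec n" "u \<in> carrier_vec n" "X \<subseteq> {l..u}"
proof -
  obtain ng nc c G A b where c: "c \<in> carrier_vec n" and G: "G \<in> carrier_mat n ng"
    and X: "X = {c + G *\<^sub>v \<xi> | \<xi>. \<xi> \<in> carrier_vec ng \<and> linf_norm_vec \<xi> \<le> 1 \<and> A *\<^sub>v \<xi> = (b :: real vec)}"
    using assms unfolding constrained_zonotope_def by blast
  define r where "r = vec n (\<lambda>i. \<Sum>j<ng. \<bar>G $$ (i, j)\<bar>)"
  have r: "r \<in> carrier_vec n" by (simp add: r_def)
  have bound: "\<bar>(G *\<^sub>v \<xi>) $ i\<bar> \<le> r $ i"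
    if \<xi>: "\<xi> \<in> carrier_vec ng" "linf_norm_vec \<xi> \<le> 1" and i: "i < n" for \<xi> i
  proof -
    have le1: "\<bar>\<xi> $ j\<bar> \<le> 1" if "j < ng" for j
      using that \<xi> by (simp add: linf_norm_vec_def)
    have "(G *\<^sub>v \<xi>) $ i = (\<Sum>j<ng. G $$ (i, j) * \<xi> $ j)"
      using G \<xi>(1) i by (simp add: scalar_prod_def atLeast0LessThan)
    also have "\<bar>\<dots>\<bar> \<le> (\<Sum>j<ng. \<bar>G $$ (i, j) * \<xi> $ j\<bar>)"
      by (rule sum_abs)
    also have "\<dots> \<le> (\<Sum>j<ng. \<bar>G $$ (i, j)\<bar>)"
      using le1 by (intro sum_mono) (simp add: abs_mult mult_left_le)
    finally show ?thesis using i by (simp add: r_def)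
  qed
  have "X \<subseteq> {c - r..c + r}"
  proof
    fix x assume "x \<in> X"
    then obtain \<xi> where \<xi>: "\<xi> \<in> carrier_vec ng" "linf_norm_vec \<xi> \<le> 1"
      and x: "x = c + G *\<^sub>v \<xi>"
      using X by blast
    have "c $ i - r $ i \<le> x $ i \<and> x $ i \<le> c $ i + r $ i" if "i < n" for i
      \<comment> \<open>The entry \<open>(G *\<^sub>v \<xi>) $ i\<close> must stay an atom to match
        \<open>bound\<close>, hence the deleted simp rule.\<close>
      using bound[OF \<xi> that] that c G by (simp add: x abs_le_iff del: index_mult_mat_vec)
    then show "x \<in> {c - r..c + r}"
      using c r G by (simp add: less_eq_vec_def x)
  qed
  moreover have "c - r \<in> carrier_vec n" "c + r \<in> carrier_vec n"
    using c r by simp_all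
  ultimately show thesis by (rule that[rotated 2])
qed

text \<open>Comparability of vectors already includes equality of dimensions, so the upper bound
  passes its dimension on to \<open>v\<close>.\<close>

lemma atLeastAtMost_carrier_vec:
  assumes "v \<in> {l..u}" "u \<in> carrier_vec n"
  shows "v \<in> carrier_vec n"
proof -
  have "v \<le> u" using assms(1) by simp
  then have "dim_vec v = dim_vec u" unfolding less_eq_vec_def by blast
  then show ?thesis using carrier_vecD[OF assms(2)] by (intro carrier_vecI) (rule trans)
qed

text \<open>Concatenation respects the componentwise order because the members of \<open>X\<close>
  have the same length as its bounds, so both sides split at the same index.\<close>

lemma vec_times_bounded:
  fixes l\<^sub>1 :: "'a :: preorder vec"
  assumes "l\<^sub>1 \<in> carrier_vec m" "u\<^sub>1 \<in> carrier_vec m" "X \<subseteq> {l\<^sub>1..u\<^sub>1}"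
    and "l\<^sub>2 \<in> carrier_vec n" "u\<^sub>2 \<in> carrier_vec n" "Y \<subseteq> {l\<^sub>2..u\<^sub>2}"
  shows "X \<times>\<^sub>v Y \<subseteq> {l\<^sub>1 @\<^sub>v l\<^sub>2..u\<^sub>1 @\<^sub>v u\<^sub>2}"
proof
  fix z assume "z \<in> X \<times>\<^sub>v Y"
  then obtain x y where z: "z = x @\<^sub>v y" and x: "x \<in> {l\<^sub>1..u\<^sub>1}" and y: "y \<in> {l\<^sub>2..u\<^sub>2}"
    using assms(3,6) unfolding vec_times_def by blast
  have dim: "dim_vec x = m" "dim_vec y = n"
    using atLeastAtMost_carrier_vec[OF x assms(2)] atLeastAtMost_carrier_vec[OF y assms(5)]
    by simp_all
  show "z \<in> {l\<^sub>1 @\<^sub>v l\<^sub>2..u\<^sub>1 @\<^sub>v u\<^sub>2}"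
    using x y dim assms(1,2,4,5) by (simp add: z less_eq_vec_def)
qed

lemma append_vec_assoc: "(x @\<^sub>v y) @\<^sub>v z = x @\<^sub>v y @\<^sub>v z"
  by (intro eq_vecI) auto

text \<open>The first \<open>ns\<close> factors are the coordinate functions, so the head of
  \<open>\<zeta> s\<close> is \<open>s\<close> itself. Since \<open>ns \<le> nz\<close>, the natural
  subtraction gives the exact length of the rest.\<close>

lemma factor_sequence_decompose:
  assumes \<zeta>: "factor_sequence L ns nz D \<zeta>" and s: "s \<in> D"
  shows "\<zeta> s = s @\<^sub>v vec_last (\<zeta> s) (nz - ns)"
proof -
  have le: "ns \<le> nz" and D: "s \<in> carrier_vec ns" and c: "\<zeta> s \<in> carrier_vec nz"
    and init: "\<And>j. j < ns \<Longrightarrow> \<zeta> s $ j = s $ j"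
    using \<zeta> s unfolding factor_sequence_def by blast+
  have "vec_first (\<zeta> s) ns = s"
    using D init by (intro eq_vecI) (simp_all add: vec_first_def)
  then show ?thesis
    using vec_first_last_append[of "\<zeta> s" ns "nz - ns"] le c by simp
qed

theorem proposition3:
  fixes nx nw nu nv ny ns nz :: nat
    and L :: "(real \<rightharpoonup> real) set"
    and f g l \<zeta> :: "real vec \<Rightarrow> real vec"
    and X W V S D Z Ztail Pl Py Xk Xhat :: "real vec set"
    and u y :: "real vec"
    and El Ef :: "real mat"
  assumes X: "constrained_zonotope nx X" "X \<noteq> {}"
    and W: "constrained_zonotope nw W" "W \<noteq> {}"
    and V: "constrained_zonotope nv V" "V \<noteq> {}"
    and u: "u \<in> carrier_vec nu"
    and y: "y \<in> carrier_vec ny"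
    and f: "f \<in> carrier_vec (nx + nw + nu) \<rightarrow> carrier_vec nx"
      "factorable L (nx + nw + nu) nx (carrier_vec (nx + nw + nu)) f"
    and g: "g \<in> carrier_vec (nx + nv) \<rightarrow> carrier_vec ny"
      "factorable L (nx + nv) ny (carrier_vec (nx + nv)) g"
    and l: "\<And>x w v. \<lbrakk>x \<in> carrier_vec nx; w \<in> carrier_vec nw; v \<in> carrier_vec nv\<rbrakk>
      \<Longrightarrow> l (x @\<^sub>v w @\<^sub>v v) = g (f (x @\<^sub>v w @\<^sub>v u) @\<^sub>v v)"
    and ns: "ns = nx + nw + nv"
    and S: "S = X \<times>\<^sub>v W \<times>\<^sub>v V"
    and D: "interval_hull ns S \<subseteq> D"
    and \<zeta>: "factor_sequence L ns nz D \<zeta>"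
    and El: "selection_matrix ny nz El" "\<And>s. s \<in> D \<Longrightarrow> l s = El *\<^sub>v \<zeta> s"
    and Ef: "selection_matrix nx nz Ef"
      "\<And>x w v. \<lbrakk>x \<in> carrier_vec nx; w \<in> carrier_vec nw; v \<in> carrier_vec nv; x @\<^sub>v w @\<^sub>v v \<in> D\<rbrakk>
        \<Longrightarrow> f (x @\<^sub>v w @\<^sub>v u) = Ef *\<^sub>v \<zeta> (x @\<^sub>v w @\<^sub>v v)"
    and Xk: "Xk = {xk \<in> carrier_vec nx. \<exists>x \<in> X. \<exists>w \<in> W. \<exists>v \<in> V.
        xk = f (x @\<^sub>v w @\<^sub>v u) \<and> y = g (xk @\<^sub>v v)}"
    and Z: "compact_interval nz Z" "\<zeta> ` interval_hull ns S \<subseteq> Z"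
    and Pl: "convex_polyhedron nz Pl" "\<zeta> ` interval_hull ns S \<subseteq> Pl"
    and Ztail: "Ztail = (\<lambda>z. vec_last z (nz - ns)) ` Z"
    and Py: "Py = {z \<in> carrier_vec nz. El *\<^sub>v z = y}"
    and Xhat: "Xhat = (\<lambda>z. Ef *\<^sub>v z) ` ((X \<times>\<^sub>v W \<times>\<^sub>v V \<times>\<^sub>v Ztail) \<inter> Pl \<inter> Py)"
  shows "Xk \<subseteq> Xhat"
proof
  obtain lX uX where bX: "lX \<in> carrier_vec nx" "uX \<in> carrier_vec nx" "X \<subseteq> {lX..uX}"
    using X(1) by (rule constrained_zonotope_bounded)
  obtain lW uW where bW: "lW \<in> carrier_vec nw" "uW \<in> carrier_vec nw" "W \<subseteq> {lW..uW}"
    using W(1) by (rule constrained_zonotope_bounded)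
  obtain lV uV where bV: "lV \<in> carrier_vec nv" "uV \<in> carrier_vec nv" "V \<subseteq> {lV..uV}"
    using V(1) by (rule constrained_zonotope_bounded)
  have "S \<subseteq> {lX @\<^sub>v lW @\<^sub>v lV..uX @\<^sub>v uW @\<^sub>v uV}"
    unfolding S
    by (intro vec_times_bounded[OF bX append_carrier_vec[OF bW(1) bV(1)] append_carrier_vec[OF bW(2) bV(2)]]
        vec_times_bounded[OF bW bV])
  moreover have "lX @\<^sub>v lW @\<^sub>v lV \<in> carrier_vec ns" "uX @\<^sub>v uW @\<^sub>v uV \<in> carrier_vec ns"
    \<comment> \<open>The sum in \<open>ns\<close> nests to the left but the concatenation to the
      right.\<close>
    unfolding ns add.assoc by (intro append_carrier_vec bX bW bV)+
  \<comment> \<open>Compact intervals are nonempty by definition, so in positive dimension the empty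
    set would have no least one around it.\<close>
  moreover have "S \<noteq> {}"
    using X(2) W(2) V(2) unfolding S vec_times_def by blast
  ultimately have hull: "S \<subseteq> interval_hull ns S"
    by (intro interval_hull_exists(2))
  fix xk assume "xk \<in> Xk"
  then obtain x w v where mem: "x \<in> X" "w \<in> W" "v \<in> V"
    and xk: "xk = f (x @\<^sub>v w @\<^sub>v u)" and meas: "y = g (xk @\<^sub>v v)"
    unfolding Xk by blast
  \<comment> \<open>The dimensions are read off from the bounding boxes found above.\<close>
  have carrier: "x \<in> carrier_vec nx" "w \<in> carrier_vec nw" "v \<in> carrier_vec nv"
    by (rule atLeastAtMost_carrier_vec[OF subsetD[OF bX(3) mem(1)] bX(2)]
        atLeastAtMost_carrier_vec[OF subsetD[OF bW(3) mem(2)] bW(2)]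
        atLeastAtMost_carrier_vec[OF subsetD[OF bV(3) mem(3)] bV(2)])+
  define s where "s = x @\<^sub>v w @\<^sub>v v"
  have s: "s \<in> interval_hull ns S"
    using hull mem unfolding S s_def vec_times_def by blast
  then have sD: "s \<in> D" using D by blast
  define t where "t = vec_last (\<zeta> s) (nz - ns)"
  \<comment> \<open>\<open>Ztail\<close> is the projection of \<open>Z\<close> to its last
    components, and \<open>\<zeta> s\<close> lies in \<open>Z\<close> because \<open>s\<close> is in
    the hull.\<close>
  have "t \<in> Ztail" using Z(2) s unfolding Ztail t_def by blast
  \<comment> \<open>Reassociation brings the decomposition into the right-nested shape of the
    fourfold product.\<close>
  moreover have "\<zeta> s = x @\<^sub>v w @\<^sub>v v @\<^sub>v t"
    using factor_sequence_decompose[OF \<zeta> sD] by (simp add: s_def t_def append_vec_assoc)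
  ultimately have "\<zeta> s \<in> X \<times>\<^sub>v W \<times>\<^sub>v V \<times>\<^sub>v Ztail"
    using mem unfolding vec_times_def by blast
  moreover have "\<zeta> s \<in> Pl" using Pl(2) s by blast
  moreover have "\<zeta> s \<in> Py"
  proof -
    have "\<zeta> s \<in> carrier_vec nz" using \<zeta> sD unfolding factor_sequence_def by blast
    \<comment> \<open>Both sides equal \<open>l s\<close>: on the left by selection of factors, on
      the right because substituting \<open>xk\<close> into the measurement equation yields the
      composite at \<open>s\<close>.\<close>
    moreover have "El *\<^sub>v \<zeta> s = y"
      using El(2)[OF sD] l[OF carrier] meas xk by (simp add: s_def)
    ultimately show ?thesis unfolding Py by simp
  qed
  moreover have "xk = Ef *\<^sub>v \<zeta> s"
    using Ef(2)[OF carrier] sD xk by (simp add: s_def)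
  ultimately show "xk \<in> Xhat" unfolding Xhat by blast
qed

end
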